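(* Let $\gamma$ be an elliptic orbit with (irrational, positive) monodromy angle $\theta$, let $t$ be a positive integer, and let $r$ be the length of the partition $p^+_\theta(t)$. Then $$2A(\theta,t)=\theta t^2-\operatorname{gr}(\gamma^t)+t+\lfloor t\theta\rfloor+r.$$
   Context: For an irrational $\theta>0$ and a positive integer $t$, the maximal concave lattice path for $(\theta,t)$ is the maximal concave piecewise linear path in the first quadrant that starts at $(0,0)$, ends at $(t,\lfloor t\theta\rfloor)$, has vertices at lattice points and stays below the line $y=\theta x$; it is subdivided so that its edges have no interior lattice points. The positive ECH partition $p^+_\theta(t)$ is the partition of $t$ given by the horizontal displacements of the edges of this path; its length is the number of edges. $A(\theta,t)$ is the area of the region in the first quadrant bounded by the line $y=\theta x$, the vertical segment from $(t,\lfloor t\theta\rfloor)$ to $(t,t\theta)$, and this maximal concave path. The Conley–Zehnder index of the $i$-fold cover of $\gamma$ is $CZ(\gamma^i)=2\lfloor i\theta\rfloor+1$, and the grading is $\operatorname{gr}(\gamma^t)=t+\sum_{i=1}^tCZ(\gamma^i)$. *)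

theory Defs
  imports "HOL-Analysis.Analysis" "HOL-Library.Multiset"
begin

type_synonym lattice_point = "int \<times> int"

definition to_plane :: "lattice_point \<Rightarrow> real \<times> real" where
  "to_plane p = (of_int (fst p), of_int (snd p))"

(* A piecewise linear path is given by the list of its vertices, ordered by strictly increasing
   abscissa; path_height vs x is the height of the path over x. It is only meaningful for x
   between the abscissae of the first and the last vertex. *)
fun path_height :: "lattice_point list \<Rightarrow> real \<Rightarrow> real" where
  "path_height [] x = 0"
| "path_height [p] x = of_int (snd p)"
| "path_height (p # q # ps) x =
     (if x \<le> of_int (fst q)
      then of_int (snd p)
           + of_int (snd q - snd p) / of_int (fst q - fst p) * (x - of_int (fst p))
      else path_height (q # ps) x)"

(* The line is weakly bounding: every path meets it at the origin. For irrational slope this is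
   the only lattice point on it. *)
definition concave_lattice_path :: "real \<Rightarrow> nat \<Rightarrow> lattice_point list \<Rightarrow> bool" where
  "concave_lattice_path \<theta> t vs \<longleftrightarrow>
     vs \<noteq> [] \<and> hd vs = (0, 0) \<and> last vs = (int t, \<lfloor>real t * \<theta>\<rfloor>) \<and>
     sorted_wrt (<) (map fst vs) \<and>
     concave_on {0..real t} (path_height vs) \<and>
     (\<forall>x\<in>{0..real t}. 0 \<le> path_height vs x \<and> path_height vs x \<le> \<theta> * x)"

definition primitive_edges :: "lattice_point list \<Rightarrow> bool" where
  "primitive_edges vs \<longleftrightarrow>
     (\<forall>i. Suc i < length vs \<longrightarrow>
        open_segment (to_plane (vs ! i)) (to_plane (vs ! Suc i)) \<inter> range to_plane = {})"

(* Maximality is pointwise among all concave lattice paths, subdivided or not. It determines the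
   path as a curve; the subdivision condition then determines the vertex list. *)
definition is_maximal_path :: "real \<Rightarrow> nat \<Rightarrow> lattice_point list \<Rightarrow> bool" where
  "is_maximal_path \<theta> t vs \<longleftrightarrow>
     concave_lattice_path \<theta> t vs \<and> primitive_edges vs \<and>
     (\<forall>ws. concave_lattice_path \<theta> t ws \<longrightarrow>
        (\<forall>x\<in>{0..real t}. path_height ws x \<le> path_height vs x))"

definition maximal_path :: "real \<Rightarrow> nat \<Rightarrow> lattice_point list" where
  "maximal_path \<theta> t = (THE vs. is_maximal_path \<theta> t vs)"

(* Partitions are multisets of positive integers; the length of a partition is its size. *)
definition positive_partition :: "real \<Rightarrow> nat \<Rightarrow> nat multiset" where
  "positive_partition \<theta> t =
     (let vs = maximal_path \<theta> t
      in mset (map (\<lambda>(p, q). nat (fst q - fst p)) (zip vs (tl vs))))"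

definition region_area :: "real \<Rightarrow> nat \<Rightarrow> real" where
  "region_area \<theta> t =
     measure lborel {(x, y). 0 \<le> x \<and> x \<le> real t \<and>
                             path_height (maximal_path \<theta> t) x \<le> y \<and> y \<le> \<theta> * x}"

(* An elliptic orbit enters only through its monodromy angle: conley_zehnder \<theta> i is the
   index of the i-fold cover of an elliptic orbit with monodromy angle \<theta>. *)
definition conley_zehnder :: "real \<Rightarrow> nat \<Rightarrow> int" where
  "conley_zehnder \<theta> i = 2 * \<lfloor>real i * \<theta>\<rfloor> + 1"

definition grading :: "real \<Rightarrow> nat \<Rightarrow> int" where
  "grading \<theta> t = int t + (\<Sum>i=1..t. conley_zehnder \<theta> i)"

end

theory Submission
  imports Defs
begin

text \<open>The maximal path is the upper boundary of the convex hull of the points \<open>(i, f i)\<close> with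
  \<open>f i = \<lfloor>i \<theta>\<rfloor>\<close> and \<open>0 \<le> i \<le> t\<close>, and its vertices are exactly those of these points that lie
  on it. Over an integer \<open>i\<close> its height has integer part \<open>f i\<close>, so Pick's theorem for the region
  below the path, applied edge by edge, expresses twice the area of that region as
  \<open>2 (\<Sum>i=1..t. f i) + t - f t - r\<close>; subtracting this from \<open>\<theta> t\<^sup>2\<close> gives the formula.\<close>

section \<open>Piecewise linear paths and their edges\<close>

text \<open>The affine piece of \<open>path_height\<close> gets a name of its own because it is also
  evaluated away from its edge, as a supporting line of the whole path.\<close>

definition edge_line :: "lattice_point \<Rightarrow> lattice_point \<Rightarrow> real \<Rightarrow> real" where
  "edge_line p q x =
     of_int (snd p) + of_int (snd q - snd p) / of_int (fst q - fst p) * (x - of_int (fst p))"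

lemma edge_line_left [simp]: "edge_line p q (of_int (fst p)) = of_int (snd p)"
  by (simp add: edge_line_def)

lemma edge_line_right [simp]:
  "fst p < fst q \<Longrightarrow> edge_line p q (of_int (fst q)) = of_int (snd q)"
  by (simp add: edge_line_def flip: of_int_diff)

lemma edge_line_affine:
  assumes "u + v = 1"
  shows "edge_line p q (u * x + v * y) = u * edge_line p q x + v * edge_line p q y"
proof -
  have v: "v = 1 - u" using assms by simp
  have "c + m * (u * x + v * y - a) = u * (c + m * (x - a)) + v * (c + m * (y - a))"
    for c m a :: real unfolding v by (simp add: algebra_simps)
  then show ?thesis by (simp only: edge_line_def)
qed

lemma continuous_on_edge_line: "continuous_on S (edge_line p q)"
  unfolding edge_line_def by (intro continuous_intros)

lemma path_height_Cons2:
  "path_height (p # q # ps) x =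
     (if x \<le> of_int (fst q) then edge_line p q x else path_height (q # ps) x)"
  by (simp add: edge_line_def)

declare path_height.simps(3) [simp del]

lemma path_height_measurable [measurable]: "path_height vs \<in> borel_measurable borel"
proof (induction vs rule: induct_list012)
  case (3 p q ps)
  have [measurable]: "edge_line p q \<in> borel_measurable borel"
    by (intro borel_measurable_continuous_onI continuous_on_edge_line)
  note 3(2) [measurable]
  show ?case unfolding path_height_Cons2 by measurable
qed simp_all

lemma path_height_vertex:
  assumes "sorted_wrt (<) (map fst vs)" "v \<in> set vs"
  shows "path_height vs (of_int (fst v)) = of_int (snd v)"
  using assms
proof (induction vs rule: induct_list012)
  case (3 p q ps)
  then show ?case by (force simp: path_height_Cons2)
qed auto

lemma path_height_edge:
  assumes "sorted_wrt (<) (map fst vs)" "2 \<le> length vs"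
    and "of_int (fst (hd vs)) \<le> x" "x \<le> of_int (fst (last vs))"
  obtains k where "Suc k < length vs"
    and "of_int (fst (vs ! k)) \<le> x" "x \<le> of_int (fst (vs ! Suc k))"
    and "path_height vs x = edge_line (vs ! k) (vs ! Suc k) x"
proof -
  have "\<exists>k. Suc k < length vs \<and> of_int (fst (vs ! k)) \<le> x \<and> x \<le> of_int (fst (vs ! Suc k)) \<and>
            path_height vs x = edge_line (vs ! k) (vs ! Suc k) x"
    using assms
  proof (induction vs rule: induct_list012)
    case (3 p q ps)
    show ?case
    proof (cases "x \<le> of_int (fst q)")
      case True
      with 3 show ?thesis by (intro exI[of _ 0]) (simp add: path_height_Cons2)
    next
      case False
      with 3(6) have "ps \<noteq> []" by auto
      then have "2 \<le> length (q # ps)" by (cases ps) auto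
      with 3 False obtain k where "Suc k < length (q # ps)"
        "of_int (fst ((q # ps) ! k)) \<le> x" "x \<le> of_int (fst ((q # ps) ! Suc k))"
        "path_height (q # ps) x = edge_line ((q # ps) ! k) ((q # ps) ! Suc k) x"
        by auto
      with False show ?thesis by (intro exI[of _ "Suc k"]) (simp add: path_height_Cons2)
    qed
  qed auto
  then show thesis using that by blast
qed

lemma sorted_nth_less:
  assumes "sorted_wrt (<) (map fst vs)" "Suc k < length vs"
  shows "fst (vs ! k) < fst (vs ! Suc k)"
  using sorted_wrt_nth_less[OF assms(1), of k "Suc k"] assms(2) by simp

lemma sorted_path_bounds:
  fixes vs :: "lattice_point list"
  assumes "sorted_wrt (<) (map fst vs)" "v \<in> set vs"
  shows "fst (hd vs) \<le> fst v" "fst v \<le> fst (last vs)"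
proof -
  obtain k where k: "k < length vs" "v = vs ! k"
    using assms(2) by (auto simp: in_set_conv_nth)
  have s: "sorted (map fst vs)" using assms(1) strict_sorted_imp_sorted by blast
  have "vs \<noteq> []" using k by auto
  then show "fst (hd vs) \<le> fst v" "fst v \<le> fst (last vs)"
    using sorted_nth_mono[OF s, of 0 k] sorted_nth_mono[OF s, of k "length vs - 1"] k
    by (auto simp: hd_conv_nth last_conv_nth)
qed

text \<open>Abscissa and height are interpolated with the same weight \<open>s\<close>. Bounds at
  the vertices thereby pass to the whole path, and a point of the path is recognised as a point of a
  segment.\<close>

lemma path_height_convexE:
  assumes vs: "sorted_wrt (<) (map fst vs)" "2 \<le> length vs"
    and x: "of_int (fst (hd vs)) \<le> x" "x \<le> of_int (fst (last vs))"
  obtains k p q s where "Suc k < length vs" "p = vs ! k" "q = vs ! Suc k"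
    and "p \<in> set vs" "q \<in> set vs" "fst p < fst q" "0 \<le> s" "s \<le> 1"
    and "x = (1 - s) * of_int (fst p) + s * of_int (fst q)"
    and "path_height vs x = (1 - s) * of_int (snd p) + s * of_int (snd q)"
proof -
  obtain k where k: "Suc k < length vs"
    "of_int (fst (vs ! k)) \<le> x" "x \<le> of_int (fst (vs ! Suc k))"
    "path_height vs x = edge_line (vs ! k) (vs ! Suc k) x"
    using path_height_edge[OF vs x] .
  define p q where "p = vs ! k" and "q = vs ! Suc k"
  define a b :: real where "a = of_int (fst p)" and "b = of_int (fst q)"
  define s where "s = (x - a) / (b - a)"
  have pq: "fst p < fst q" using sorted_nth_less[OF vs(1) k(1)] by (simp add: p_def q_def)
  then have ab: "a < b" "a \<le> x" "x \<le> b"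
    using k(2,3) by (simp_all add: a_def b_def p_def q_def)
  then have s: "0 \<le> s" "s \<le> 1" "s * (b - a) = x - a" by (simp_all add: s_def)
  have xs: "x = (1 - s) * a + s * b" using s(3) by (simp add: algebra_simps)
  have "path_height vs x = (1 - s) * of_int (snd p) + s * of_int (snd q)"
  proof -
    have "path_height vs x = edge_line p q x" using k(4) by (simp add: p_def q_def)
    also have "\<dots> = (1 - s) * edge_line p q a + s * edge_line p q b"
      unfolding xs by (rule edge_line_affine) simp
    finally show ?thesis using pq by (simp add: a_def b_def)
  qed
  then show thesis
    using that[of k p q s] k(1) p_def q_def pq s(1,2) xs by (simp add: a_def b_def)
qed

text \<open>Each edge is a chord whose ends lie under \<open>c\<close>, and concavity keeps the
  chord under \<open>c\<close>. This is applied with \<open>c\<close> the bounding line, the line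
  through a hull edge, and the height of the hull path.\<close>

lemma path_height_le_concave:
  assumes ws: "sorted_wrt (<) (map fst ws)" "2 \<le> length ws"
    and c: "concave_on {of_int (fst (hd ws))..of_int (fst (last ws))} c"
    and le: "\<And>v. v \<in> set ws \<Longrightarrow> of_int (snd v) \<le> c (of_int (fst v))"
    and x: "of_int (fst (hd ws)) \<le> x" "x \<le> of_int (fst (last ws))"
  shows "path_height ws x \<le> c x"
proof -
  obtain k p q s where pq: "fst p < fst q" "p \<in> set ws" "q \<in> set ws"
    and s: "0 \<le> s" "s \<le> 1" "x = (1 - s) * of_int (fst p) + s * of_int (fst q)"
    and h: "path_height ws x = (1 - s) * of_int (snd p) + s * of_int (snd q)"
    by (rule path_height_convexE[OF ws x])
  note h
  also have "(1 - s) * of_int (snd p) + s * of_int (snd q)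
      \<le> (1 - s) * c (of_int (fst p)) + s * c (of_int (fst q))"
    using le pq s by (intro add_mono mult_left_mono) auto
  also have "\<dots> \<le> c x"
    using concave_onD[OF c s(1,2), of "of_int (fst p)" "of_int (fst q)"]
      sorted_path_bounds[OF ws(1) pq(2)] sorted_path_bounds[OF ws(1) pq(3)]
    by (simp add: s(3))
  finally show ?thesis .
qed

lemma path_height_nonneg:
  assumes ws: "sorted_wrt (<) (map fst ws)" "2 \<le> length ws"
    and nonneg: "\<And>v. v \<in> set ws \<Longrightarrow> 0 \<le> snd v"
    and x: "of_int (fst (hd ws)) \<le> x" "x \<le> of_int (fst (last ws))"
  shows "0 \<le> path_height ws x"
proof -
  obtain k p q s where pq: "fst p < fst q" "p \<in> set ws" "q \<in> set ws"
    and s: "0 \<le> s" "s \<le> 1" "x = (1 - s) * of_int (fst p) + s * of_int (fst q)"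
    and h: "path_height ws x = (1 - s) * of_int (snd p) + s * of_int (snd q)"
    by (rule path_height_convexE[OF ws x])
  then show ?thesis using nonneg pq s by simp
qed

lemma concave_on_edge_line: "convex S \<Longrightarrow> concave_on S (edge_line p q)"
  by (simp add: concave_on_iff edge_line_affine)

section \<open>Concave lattice paths and uniqueness of the maximal one\<close>

text \<open>A vertex has an integer ordinate, so its bound by the line of slope \<theta> rounds down
  to the floor. Competing paths are thus controlled by the graph of the floor function
  alone.\<close>

lemma concave_pathD:
  assumes "concave_lattice_path \<theta> t vs" "t > 0"
  shows "sorted_wrt (<) (map fst vs)" "2 \<le> length vs" "hd vs = (0, 0)"
    "last vs = (int t, \<lfloor>real t * \<theta>\<rfloor>)"
    "\<And>v. v \<in> set vs \<Longrightarrow> 0 \<le> fst v \<and> fst v \<le> int t \<and> snd v \<le> \<lfloor>of_int (fst v) * \<theta>\<rfloor>"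
proof -
  show s: "sorted_wrt (<) (map fst vs)" and h: "hd vs = (0, 0)"
    and l: "last vs = (int t, \<lfloor>real t * \<theta>\<rfloor>)"
    using assms by (auto simp: concave_lattice_path_def)
  show "2 \<le> length vs" using h l assms
    by (cases vs; cases "tl vs") (auto simp: concave_lattice_path_def)
  fix v assume v: "v \<in> set vs"
  have b: "0 \<le> fst v" "fst v \<le> int t" using sorted_path_bounds[OF s v] h l by auto
  then have "path_height vs (of_int (fst v)) \<le> \<theta> * of_int (fst v)"
    using assms by (auto simp: concave_lattice_path_def)
  then show "0 \<le> fst v \<and> fst v \<le> int t \<and> snd v \<le> \<lfloor>of_int (fst v) * \<theta>\<rfloor>"
    using b path_height_vertex[OF s v] by (simp add: le_floor_iff mult.commute)
qed

text \<open>A vertex of \<open>vs\<close> lies on the common curve, hence on some edge of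
  \<open>ws\<close>. It must be an end of that edge, since primitive edges have no lattice point in
  their interior.\<close>

lemma vertices_subset:
  assumes t: "t > 0"
    and vs: "concave_lattice_path \<theta> t vs" and ws: "concave_lattice_path \<theta> t ws"
    and prim: "primitive_edges ws"
    and eq: "\<And>x. x \<in> {0..real t} \<Longrightarrow> path_height vs x = path_height ws x"
  shows "set vs \<subseteq> set ws"
proof
  fix v assume v: "v \<in> set vs"
  note V = concave_pathD[OF vs t] and W = concave_pathD[OF ws t]
  let ?x = "of_int (fst v) :: real"
  have x: "of_int (fst (hd ws)) \<le> ?x" "?x \<le> of_int (fst (last ws))"
    using V(5)[OF v] W(3,4) by auto
  obtain k p q s where k: "Suc k < length ws" "p = ws ! k" "q = ws ! Suc k"
    and pq: "p \<in> set ws" "q \<in> set ws" "fst p < fst q"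
    and s: "0 \<le> s" "s \<le> 1" "?x = (1 - s) * of_int (fst p) + s * of_int (fst q)"
    and h: "path_height ws ?x = (1 - s) * of_int (snd p) + s * of_int (snd q)"
    by (rule path_height_convexE[OF W(1,2) x])
  have y': "of_int (snd v) = (1 - s) * of_int (snd p) + s * of_int (snd q)"
    using h eq[of ?x] V(5)[OF v] path_height_vertex[OF V(1) v] by simp
  consider "s = 0" | "s = 1" | "0 < s" "s < 1" using s by linarith
  then show "v \<in> set ws"
  proof cases
    case 1
    then have "v = p" using s(3) y' by (simp add: prod_eq_iff)
    then show ?thesis using pq by simp
  next
    case 2
    then have "v = q" using s(3) y' by (simp add: prod_eq_iff)
    then show ?thesis using pq by simp
  next
    case 3
    have "to_plane v = (1 - s) *\<^sub>R to_plane p + s *\<^sub>R to_plane q"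
      using s(3) y' by (simp add: to_plane_def)
    moreover have "to_plane p \<noteq> to_plane q" using pq by (auto simp: to_plane_def)
    ultimately have "to_plane v \<in> open_segment (to_plane p) (to_plane q)"
      using 3 by (auto simp: in_segment)
    with prim k show ?thesis by (auto simp: primitive_edges_def)
  qed
qed

text \<open>Two maximal paths dominate each other, so they are the same curve and, by primitivity of
  both, have the same vertex set. Ordering by abscissa then determines the list.\<close>

lemma is_maximal_path_unique:
  assumes t: "t > 0" and vs: "is_maximal_path \<theta> t vs" and ws: "is_maximal_path \<theta> t ws"
  shows "vs = ws"
proof -
  have eq: "path_height vs x = path_height ws x" if "x \<in> {0..real t}" for x
    using vs ws that by (auto simp: is_maximal_path_def intro: antisym)
  have set: "set vs = set ws"
    using vs ws eq by (intro equalityI vertices_subset[OF t]) (auto simp: is_maximal_path_def)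
  have s: "sorted_wrt (<) (map fst vs)" "sorted_wrt (<) (map fst ws)"
    using vs ws by (auto simp: is_maximal_path_def concave_lattice_path_def)
  have "map fst vs = map fst ws" using s set by (intro strict_sorted_equal) auto
  moreover have "inj_on fst (set vs \<union> set ws)"
  proof -
    have "distinct (map fst vs)" using s(1) unfolding strict_sorted_iff by blast
    then show ?thesis by (simp add: distinct_map set)
  qed
  ultimately show ?thesis by (rule map_inj_on)
qed

section \<open>The upper convex hull of the graph of an integer function\<close>

text \<open>The condition compares the slope from \<open>i\<close> to \<open>b\<close> with that
  from \<open>a\<close> to \<open>i\<close>, with denominators cleared: no chord of the graph passes
  strictly above \<open>(i, f i)\<close>. The inequality is weak so that graph points inside a hull
  edge are kept, which subdivides the path.\<close>

definition hull_abscissae :: "(int \<Rightarrow> int) \<Rightarrow> int \<Rightarrow> int set" where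
  "hull_abscissae f n =
     {i \<in> {0..n}. \<forall>a b. 0 \<le> a \<longrightarrow> a < i \<longrightarrow> i < b \<longrightarrow> b \<le> n \<longrightarrow>
        (f b - f i) * (i - a) \<le> (f i - f a) * (b - i)}"

text \<open>A point of the graph that maximises the excess over the line through two consecutive hull
  points is itself a hull point, so all points strictly between them lie strictly below that
  line.\<close>

lemma hull_below_edge:
  assumes u: "u \<in> hull_abscissae f n" and w: "w \<in> hull_abscissae f n" and "u < w"
    and gap: "\<And>i. u < i \<Longrightarrow> i < w \<Longrightarrow> i \<notin> hull_abscissae f n"
    and i: "0 \<le> i" "i \<le> n"
  shows "(w - u) * (f i - f u) \<le> (f w - f u) * (i - u)"
    and "u < i \<Longrightarrow> i < w \<Longrightarrow> (w - u) * (f i - f u) < (f w - f u) * (i - u)"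
proof -
  \<comment> \<open>The excess over the line through the points at \<open>u\<close> and
    \<open>w\<close>, scaled by \<open>w - u\<close> to remain an integer; it vanishes at
    \<open>u\<close> and at \<open>w\<close>.\<close>
  define g where "g i = (w - u) * (f i - f u) - (f w - f u) * (i - u)" for i
  have uw: "0 \<le> u" "w \<le> n" using u w by (auto simp: hull_abscissae_def)
  have left: "g a \<le> 0" if "0 \<le> a" "a \<le> u" for a
  proof (cases "a = u")
    case False
    then have "(f w - f u) * (u - a) \<le> (f u - f a) * (w - u)"
      using u uw that \<open>u < w\<close> by (auto simp: hull_abscissae_def)
    then show ?thesis by (simp add: g_def algebra_simps)
  qed (simp add: g_def)
  have right: "g b \<le> 0" if "w \<le> b" "b \<le> n" for b
  proof (cases "b = w")
    case False
    then have "(f b - f w) * (w - u) \<le> (f w - f u) * (b - w)"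
      using w uw that \<open>u < w\<close> by (auto simp: hull_abscissae_def)
    then show ?thesis by (simp add: g_def algebra_simps)
  qed (simp add: g_def)
  have mid: "g j < 0" if j: "u < j" "j < w" for j
  proof (rule ccontr)
    assume "\<not> g j < 0"
    have "Max (g ` {u<..<w}) \<in> g ` {u<..<w}" using j by (intro Max_in) auto
    then obtain m where m: "m \<in> {u<..<w}" and "g m = Max (g ` {u<..<w})" by auto
    then have max: "g i \<le> g m" if "i \<in> {u<..<w}" for i
      using that by simp
    \<comment> \<open>The assumption on \<open>j\<close> makes the maximum over the gap nonnegative,
      so it also dominates the nonpositive values outside the gap.\<close>
    have "0 \<le> g m" using max[of j] j \<open>\<not> g j < 0\<close> by auto
    then have top: "g i \<le> g m" if "0 \<le> i" "i \<le> n" for i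
      using left[of i] right[of i] max[of i] that by (cases "i \<le> u"; cases "w \<le> i") auto
    have "m \<in> hull_abscissae f n"
      unfolding hull_abscissae_def
    proof (intro CollectI conjI allI impI)
      fix a b assume ab: "0 \<le> a" "a < m" "m < b" "b \<le> n"
      \<comment> \<open>As \<open>g\<close> is \<open>w - u\<close> times \<open>f\<close> minus an
        affine function, the affine terms cancel in the hull condition, which may therefore be
        checked for \<open>g\<close>. There it is a matter of signs, because \<open>m\<close>
        maximises \<open>g\<close>.\<close>
      have "(g b - g m) * (m - a) \<le> 0"
        using top[of b] ab m uw by (intro mult_nonpos_nonneg) auto
      also have "0 \<le> (g m - g a) * (b - m)"
        using top[of a] ab m uw by (intro mult_nonneg_nonneg) auto
      finally have "(w - u) * ((f b - f m) * (m - a)) \<le> (w - u) * ((f m - f a) * (b - m))"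
        by (simp add: g_def algebra_simps)
      then show "(f b - f m) * (m - a) \<le> (f m - f a) * (b - m)"
        using \<open>u < w\<close> by simp
    qed (use m uw in auto)
    with gap m show False by auto
  qed
  show "u < i \<Longrightarrow> i < w \<Longrightarrow> (w - u) * (f i - f u) < (f w - f u) * (i - u)"
    using mid[of i] by (simp add: g_def)
  show "(w - u) * (f i - f u) \<le> (f w - f u) * (i - u)"
    using left[of i] mid[of i] right[of i] i by (cases "i \<le> u"; cases "w \<le> i") (auto simp: g_def)
qed

definition hull_path :: "(int \<Rightarrow> int) \<Rightarrow> int \<Rightarrow> lattice_point list" where
  "hull_path f n = map (\<lambda>i. (i, f i)) (sorted_list_of_set (hull_abscissae f n))"

lemma finite_hull_abscissae [simp]: "finite (hull_abscissae f n)"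
  by (rule finite_subset[of _ "{0..n}"]) (auto simp: hull_abscissae_def)

lemma map_fst_hull_path [simp]:
  "map fst (hull_path f n) = sorted_list_of_set (hull_abscissae f n)"
  by (simp add: hull_path_def comp_def)

lemma set_hull_path: "set (hull_path f n) = (\<lambda>i. (i, f i)) ` hull_abscissae f n"
  by (simp add: hull_path_def)

lemma sorted_hull_path: "sorted_wrt (<) (map fst (hull_path f n))"
  by simp

lemma hull_path_endpoints:
  assumes "0 < n"
  shows "hd (hull_path f n) = (0, f 0)" "last (hull_path f n) = (n, f n)"
    "2 \<le> length (hull_path f n)"
proof -
  let ?vs = "hull_path f n"
  \<comment> \<open>At \<open>0\<close> and at \<open>n\<close> the hull condition is vacuous: one
    of \<open>a\<close> and \<open>b\<close> has no room.\<close>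
  have in0: "(0, f 0) \<in> set ?vs" "(n, f n) \<in> set ?vs"
    using assms by (auto simp: set_hull_path hull_abscissae_def)
  then have ne: "?vs \<noteq> []" by auto
  have rng: "snd v = f (fst v) \<and> 0 \<le> fst v \<and> fst v \<le> n" if "v \<in> set ?vs" for v
    using that by (auto simp: set_hull_path hull_abscissae_def)
  show h: "hd ?vs = (0, f 0)"
    using sorted_path_bounds(1)[OF sorted_hull_path in0(1)] rng[OF hd_in_set[OF ne]]
    by (auto simp: prod_eq_iff)
  show l: "last ?vs = (n, f n)"
    using sorted_path_bounds(2)[OF sorted_hull_path in0(2)] rng[OF last_in_set[OF ne]]
    by (auto simp: prod_eq_iff)
  have "length ?vs \<noteq> 1" using h l assms by (auto simp: length_Suc_conv)
  moreover have "length ?vs \<noteq> 0" using ne by simp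
  ultimately show "2 \<le> length ?vs" by linarith
qed

lemma hull_path_edge:
  assumes "Suc k < length (hull_path f n)"
  obtains u w where "hull_path f n ! k = (u, f u)" "hull_path f n ! Suc k = (w, f w)"
    "u < w" "u \<in> hull_abscissae f n" "w \<in> hull_abscissae f n"
    "\<And>i. u < i \<Longrightarrow> i < w \<Longrightarrow> i \<notin> hull_abscissae f n"
proof -
  define xs where "xs = sorted_list_of_set (hull_abscissae f n)"
  have len: "Suc k < length xs" using assms by (simp add: hull_path_def xs_def)
  have set: "set xs = hull_abscissae f n" by (simp add: xs_def)
  have s: "sorted_wrt (<) xs" by (simp add: xs_def)
  show thesis
  proof (rule that[of "xs ! k" "xs ! Suc k"])
    show "hull_path f n ! k = (xs ! k, f (xs ! k))"
      "hull_path f n ! Suc k = (xs ! Suc k, f (xs ! Suc k))"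
      using len by (auto simp: hull_path_def xs_def)
    show "xs ! k < xs ! Suc k" using sorted_wrt_nth_less[OF s, of k "Suc k"] len by simp
    show "xs ! k \<in> hull_abscissae f n" "xs ! Suc k \<in> hull_abscissae f n"
      unfolding set[symmetric] using len by auto
    fix i assume i: "xs ! k < i" "i < xs ! Suc k"
    show "i \<notin> hull_abscissae f n"
    proof
      assume "i \<in> hull_abscissae f n"
      then obtain j where j: "j < length xs" "i = xs ! j"
        unfolding set[symmetric] by (auto simp: in_set_conv_nth)
      have "sorted xs" by (simp add: xs_def)
      then show False
        using i j len sorted_nth_mono[of xs j k] sorted_nth_mono[of xs "Suc k" j]
        by (cases "j \<le> k") auto
    qed
  qed
qed

lemma hull_path_below_edge_line:
  assumes k: "Suc k < length (hull_path f n)" and i: "0 \<le> i" "i \<le> n"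
  shows "of_int (f i) \<le> edge_line (hull_path f n ! k) (hull_path f n ! Suc k) (of_int i)"
proof -
  obtain u w where e: "hull_path f n ! k = (u, f u)" "hull_path f n ! Suc k = (w, f w)"
    "u < w" "u \<in> hull_abscissae f n" "w \<in> hull_abscissae f n"
    "\<And>i. u < i \<Longrightarrow> i < w \<Longrightarrow> i \<notin> hull_abscissae f n"
    using hull_path_edge[OF k] by metis
  have "(w - u) * (f i - f u) \<le> (f w - f u) * (i - u)"
    by (rule hull_below_edge(1)[OF e(4,5,3,6) i])
  then have "real_of_int ((w - u) * (f i - f u)) \<le> real_of_int ((f w - f u) * (i - u))"
    by (simp only: of_int_le_iff)
  then show ?thesis
    using e(3) by (simp add: e(1,2) edge_line_def field_simps)
qed

text \<open>The line through any hull edge supports the whole path: all graph points, in particular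
  all vertices, lie on or below it.\<close>

lemma path_height_hull_path_le_edge_line:
  assumes n: "0 < n" and k: "Suc k < length (hull_path f n)" and x: "0 \<le> x" "x \<le> of_int n"
  shows "path_height (hull_path f n) x
    \<le> edge_line (hull_path f n ! k) (hull_path f n ! Suc k) x"
proof (rule path_height_le_concave[OF sorted_hull_path hull_path_endpoints(3)[OF n]])
  fix v assume "v \<in> set (hull_path f n)"
  then show "of_int (snd v) \<le> edge_line (hull_path f n ! k) (hull_path f n ! Suc k) (of_int (fst v))"
    using hull_path_below_edge_line[OF k] by (auto simp: set_hull_path hull_abscissae_def)
qed (use x in \<open>simp_all add: hull_path_endpoints[OF n] concave_on_edge_line\<close>)

lemma hull_path_edgeE:
  assumes n: "0 < n" and x: "0 \<le> x" "x \<le> of_int n"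
  obtains k where "Suc k < length (hull_path f n)"
    "path_height (hull_path f n) x = edge_line (hull_path f n ! k) (hull_path f n ! Suc k) x"
  using path_height_edge[OF sorted_hull_path hull_path_endpoints(3)[OF n], where x = x] x
  by (auto simp: hull_path_endpoints[OF n])

text \<open>The path is the pointwise minimum of its edge lines. At a convex combination the line
  attained there is affine and bounds the path at both other points, which is concavity.\<close>

lemma concave_on_hull_path:
  assumes n: "0 < n"
  shows "concave_on {0..of_int n} (path_height (hull_path f n))"
  unfolding concave_on_iff
proof (intro conjI ballI allI impI)
  fix x y u v :: real
  assume xy: "x \<in> {0..of_int n}" "y \<in> {0..of_int n}" and uv: "0 \<le> u" "0 \<le> v" "u + v = 1"
  let ?h = "path_height (hull_path f n)"
  have "u * x + v * y \<in> {0..of_int n}"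
    using convexD[OF convex_real_interval(5)[of 0 "of_int n"] xy uv] by simp
  then obtain k where k: "Suc k < length (hull_path f n)"
    "?h (u * x + v * y) = edge_line (hull_path f n ! k) (hull_path f n ! Suc k) (u * x + v * y)"
    using hull_path_edgeE[OF n] by (metis atLeastAtMost_iff)
  have "u * ?h x + v * ?h y \<le> ?h (u * x + v * y)"
    unfolding k(2) edge_line_affine[OF uv(3)]
    using path_height_hull_path_le_edge_line[OF n k(1)] xy uv
    by (intro add_mono mult_left_mono) auto
  then show "u * ?h x + v * ?h y \<le> ?h (u *\<^sub>R x + v *\<^sub>R y)" by simp
qed simp

lemma hull_path_above_graph:
  assumes n: "0 < n" and i: "0 \<le> i" "i \<le> n"
  shows "of_int (f i) \<le> path_height (hull_path f n) (of_int i)"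
  using hull_path_edgeE[OF n, of "of_int i"] hull_path_below_edge_line[of _ f n i] i
  by (metis of_int_0_le_iff of_int_le_iff)

section \<open>Existence: the hull path is maximal\<close>

text \<open>The vertices of a competing path lie on or below the graph of \<open>f\<close>, hence
  under the concave hull path, and so does the whole competitor.\<close>

lemma is_maximal_path_hull_path:
  assumes "\<theta> > 0" "t > 0"
  defines "f \<equiv> \<lambda>i. \<lfloor>of_int i * \<theta>\<rfloor>"
  shows "is_maximal_path \<theta> t (hull_path f (int t))"
  unfolding is_maximal_path_def
proof (intro conjI allI impI ballI)
  let ?vs = "hull_path f (int t)"
  have n: "0 < int t" using assms by simp
  note E = hull_path_endpoints[OF n, of f]
  have f0: "f 0 = 0" by (simp add: f_def)
  have fle: "of_int (f i) \<le> \<theta> * of_int i" for i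
    by (simp add: f_def mult.commute of_int_floor_le)
  show "concave_lattice_path \<theta> t ?vs"
    unfolding concave_lattice_path_def
  proof (intro conjI ballI)
    show "?vs \<noteq> []" using E(3) by auto
    show "hd ?vs = (0, 0)" using E(1) f0 by simp
    show "last ?vs = (int t, \<lfloor>real t * \<theta>\<rfloor>)" using E(2) by (simp add: f_def)
    show "sorted_wrt (<) (map fst ?vs)" by simp
    show "concave_on {0..real t} (path_height ?vs)"
      using concave_on_hull_path[OF n, of f] by simp
    fix x assume x: "x \<in> {0..real t}"
    show "0 \<le> path_height ?vs x"
      by (rule path_height_nonneg[OF sorted_hull_path E(3)])
        (use x E assms in \<open>auto simp: set_hull_path hull_abscissae_def f_def\<close>)
    show "path_height ?vs x \<le> \<theta> * x"
      by (rule path_height_le_concave[OF sorted_hull_path E(3)])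
        (use x E fle in \<open>auto simp: set_hull_path concave_on_iff algebra_simps\<close>)
  qed
  show "primitive_edges ?vs"
    unfolding primitive_edges_def
  proof (intro allI impI)
    fix k assume k: "Suc k < length ?vs"
    obtain u w where e: "?vs ! k = (u, f u)" "?vs ! Suc k = (w, f w)"
      "u < w" "u \<in> hull_abscissae f (int t)" "w \<in> hull_abscissae f (int t)"
      "\<And>i. u < i \<Longrightarrow> i < w \<Longrightarrow> i \<notin> hull_abscissae f (int t)"
      using hull_path_edge[OF k] by metis
    have uw: "0 \<le> u" "w \<le> int t" using e(4,5) by (auto simp: hull_abscissae_def)
    show "open_segment (to_plane (?vs ! k)) (to_plane (?vs ! Suc k)) \<inter> range to_plane = {}"
    proof (intro equals0I)
      fix z assume "z \<in> open_segment (to_plane (?vs ! k)) (to_plane (?vs ! Suc k)) \<inter> range to_plane"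
      then obtain v where "to_plane v \<in> open_segment (to_plane (u, f u)) (to_plane (w, f w))"
        unfolding e(1,2) by auto
      then obtain s where s: "0 < s" "s < 1"
        and v: "to_plane v = (1 - s) *\<^sub>R to_plane (u, f u) + s *\<^sub>R to_plane (w, f w)"
        unfolding in_segment by blast
      define m y where "m = fst v" and "y = snd v"
      have m: "real_of_int m = (1 - s) * u + s * w"
        and y: "real_of_int y = (1 - s) * f u + s * f w"
        using v by (simp_all add: to_plane_def m_def y_def)
      have m_u: "real_of_int (m - u) = s * (w - u)" and "real_of_int (w - m) = (1 - s) * (w - u)"
        using m by (simp_all add: algebra_simps)
      then have "0 < real_of_int (m - u)" "0 < real_of_int (w - m)" using s e(3) by simp_all
      then have mid: "u < m" "m < w" by simp_all
      \<comment> \<open>Both ends of the edge lie on or below the line of slope \<theta>, so an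
        integer height \<open>y\<close> on it is at most \<open>f m\<close>. But strictly between
        consecutive hull points \<open>f m\<close> is strictly below the edge, a
        contradiction.\<close>
      have "real_of_int y \<le> (1 - s) * (\<theta> * u) + s * (\<theta> * w)"
        unfolding y using fle s by (intro add_mono mult_left_mono) auto
      also have "\<dots> = of_int m * \<theta>" unfolding m by (simp add: algebra_simps)
      finally have "y \<le> f m" by (simp add: f_def le_floor_iff)
      then have "(w - u) * (y - f u) \<le> (w - u) * (f m - f u)"
        using e(3) by (intro mult_left_mono) auto
      also have "\<dots> < (f w - f u) * (m - u)"
        using hull_below_edge(2)[OF e(4,5,3,6)] mid uw by simp
      finally have "real_of_int ((w - u) * (y - f u)) < real_of_int ((f w - f u) * (m - u))"
        by (simp only: of_int_less_iff)
      moreover have "real_of_int (y - f u) = s * (f w - f u)"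
        using y by (simp add: algebra_simps)
      ultimately show False using m_u by (simp add: of_int_mult del: of_int_diff)
    qed
  qed
  fix ws x assume ws: "concave_lattice_path \<theta> t ws" and x: "x \<in> {0..real t}"
  note W = concave_pathD[OF ws \<open>t > 0\<close>]
  show "path_height ws x \<le> path_height ?vs x"
  proof (rule path_height_le_concave[OF W(1,2)])
    fix v assume v: "v \<in> set ws"
    have "real_of_int (snd v) \<le> of_int (f (fst v))" using W(5)[OF v] by (simp add: f_def)
    also have "\<dots> \<le> path_height ?vs (of_int (fst v))"
      using W(5)[OF v] by (intro hull_path_above_graph[OF n]) auto
    finally show "of_int (snd v) \<le> path_height ?vs (of_int (fst v))" .
  qed (use x W(3,4) concave_on_hull_path[OF n, of f] in auto)
qed

section \<open>Pick's theorem along the path\<close>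

text \<open>Pick's theorem for the trapezoid under one edge: as the edge has no interior lattice point
  and \<open>f i\<close> is the integer part of its height over \<open>i\<close>, the values at \<open>i\<close> and at the mirror
  image \<open>u + w - i\<close> always add up to \<open>f u + f w - 1\<close>.\<close>

lemma sum_below_edge:
  fixes f :: "int \<Rightarrow> int"
  assumes "u < w"
    and lower: "\<And>i. u < i \<Longrightarrow> i < w \<Longrightarrow> (w - u) * (f i - f u) < (f w - f u) * (i - u)"
    and upper: "\<And>i. u < i \<Longrightarrow> i < w \<Longrightarrow> (f w - f u) * (i - u) < (w - u) * (f i + 1 - f u)"
  shows "2 * (\<Sum>i\<in>{u<..w}. f i) = (w - u) * (f u + f w) - (w - u) + (f w - f u) + 1"
proof -
  have mirror: "f i + f (u + w - i) = f u + f w - 1" if i: "u < i" "i < w" for i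
  proof -
    let ?j = "u + w - i"
    have j: "u < ?j" "?j < w" using i by auto
    \<comment> \<open>The offsets of \<open>i\<close> and \<open>?j\<close> from \<open>u\<close>
      add up to \<open>w - u\<close>, which becomes a common factor of the added bounds. The integer
      \<open>f i + f ?j\<close> is thus squeezed strictly between \<open>f u + f w - 2\<close> and
      \<open>f u + f w\<close>.\<close>
    have "(w - u) * (f i + f ?j - (f u + f w)) < (w - u) * 0"
      using lower[OF i] lower[OF j] by (simp add: algebra_simps)
    then have "f i + f ?j < f u + f w" using \<open>u < w\<close> by (simp only: mult_less_cancel_left_pos)
    moreover have "(w - u) * 0 < (w - u) * (f i + f ?j + 2 - (f u + f w))"
      using upper[OF i] upper[OF j] by (simp add: algebra_simps)
    then have "f u + f w < f i + f ?j + 2" using \<open>u < w\<close> by (simp only: mult_less_cancel_left_pos)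
    ultimately show ?thesis by linarith
  qed
  have "(\<Sum>i\<in>{u<..<w}. f i) = (\<Sum>i\<in>{u<..<w}. f (u + w - i))"
    by (rule sum.reindex_bij_witness[where i = "\<lambda>i. u + w - i" and j = "\<lambda>i. u + w - i"]) auto
  then have "2 * (\<Sum>i\<in>{u<..<w}. f i) = (\<Sum>i\<in>{u<..<w}. f i + f (u + w - i))"
    by (simp add: sum.distrib)
  also have "\<dots> = (w - u - 1) * (f u + f w - 1)"
    using mirror \<open>u < w\<close> by simp
  finally have "2 * (\<Sum>i\<in>{u<..<w}. f i) = (w - u - 1) * (f u + f w - 1)" .
  moreover have "{u<..w} = insert w {u<..<w}" using \<open>u < w\<close> by auto
  ultimately show ?thesis by (simp add: algebra_simps)
qed

lemma has_integral_edge_line: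
  assumes "fst p < fst q"
  shows "(edge_line p q has_integral
      of_int (fst q - fst p) * of_int (snd p + snd q) / 2) {of_int (fst p)..of_int (fst q)}"
proof -
  define a b m c :: real where "a = of_int (fst p)" and "b = of_int (fst q)"
    and "m = of_int (snd q - snd p) / of_int (fst q - fst p)" and "c = of_int (snd p)"
  have ab: "a < b" using assms by (simp add: a_def b_def)
  have m: "m * (b - a) = of_int (snd q) - c"
    using ab by (simp add: m_def a_def b_def c_def)
  have line: "edge_line p q = (\<lambda>x. c + m * (x - a))"
    by (simp add: edge_line_def fun_eq_iff a_def m_def c_def)
  have "((\<lambda>x. c + m * (x - a)) has_integral
      (c * b + m * (b - a)\<^sup>2 / 2) - (c * a + m * (a - a)\<^sup>2 / 2)) {a..b}"
    using ab by (intro fundamental_theorem_of_calculus)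
      (auto intro!: derivative_eq_intros simp flip: has_real_derivative_iff_has_vector_derivative)
  moreover have "(c * b + m * (b - a)\<^sup>2 / 2) - (c * a + m * (a - a)\<^sup>2 / 2)
      = (b - a) * (c + (c + m * (b - a))) / 2"
    by (simp add: power2_eq_square field_simps)
  moreover have "c + m * (b - a) = of_int (snd q)" using m by simp
  ultimately show ?thesis
    by (simp only: line a_def b_def c_def of_int_add of_int_diff)
qed

text \<open>The edge formulas are added up: the half-open ranges tile the interval, the differences
  of abscissae and ordinates telescope, and the constant 1 of each edge accumulates to the number of
  edges.\<close>

lemma has_integral_path_height:
  fixes f :: "int \<Rightarrow> int"
  assumes "sorted_wrt (<) (map fst vs)" "vs \<noteq> []"
    and "\<And>k. Suc k < length vs \<Longrightarrow>
      2 * (\<Sum>i\<in>{fst (vs ! k)<..fst (vs ! Suc k)}. f i) =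
        (fst (vs ! Suc k) - fst (vs ! k)) * (snd (vs ! k) + snd (vs ! Suc k))
          - (fst (vs ! Suc k) - fst (vs ! k)) + (snd (vs ! Suc k) - snd (vs ! k)) + 1"
  shows "(path_height vs has_integral
      (of_int (2 * (\<Sum>i\<in>{fst (hd vs)<..fst (last vs)}. f i)
        + (fst (last vs) - fst (hd vs)) - (snd (last vs) - snd (hd vs)) - int (length vs - 1))) / 2)
      {of_int (fst (hd vs))..of_int (fst (last vs))}"
  using assms
proof (induction vs rule: induct_list012)
  case (2 p)
  then show ?case by (simp add: has_integral_refl)
next
  case (3 p q ps)
  let ?l = "last (q # ps)"
  have pq: "fst p < fst q" using 3(3) by simp
  have ql: "fst q \<le> fst ?l"
    using sorted_path_bounds(2)[of "q # ps" q] 3(3) by simp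
  have edge: "2 * (\<Sum>i\<in>{fst p<..fst q}. f i) =
      (fst q - fst p) * (snd p + snd q) - (fst q - fst p) + (snd q - snd p) + 1"
    using 3(5)[of 0] by simp
  have split: "(\<Sum>i\<in>{fst p<..fst ?l}. f i) =
      (\<Sum>i\<in>{fst p<..fst q}. f i) + (\<Sum>i\<in>{fst q<..fst ?l}. f i)"
  proof -
    have "{fst p<..fst ?l} = {fst p<..fst q} \<union> {fst q<..fst ?l}" using pq ql by auto
    then show ?thesis by (simp add: sum.union_disjoint disjoint_iff)
  qed
  have IH: "(path_height (q # ps) has_integral
      (of_int (2 * (\<Sum>i\<in>{fst q<..fst ?l}. f i)
        + (fst ?l - fst q) - (snd ?l - snd q) - int (length ps))) / 2)
      {of_int (fst q)..of_int (fst ?l)}"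
    using 3(2) 3(3) 3(5)[of "Suc k" for k] by simp
  have left: "(path_height (p # q # ps) has_integral
      of_int (fst q - fst p) * of_int (snd p + snd q) / 2) {of_int (fst p)..of_int (fst q)}"
    by (rule has_integral_eq[OF _ has_integral_edge_line[OF pq]]) (simp add: path_height_Cons2)
  have right: "(path_height (p # q # ps) has_integral
      (of_int (2 * (\<Sum>i\<in>{fst q<..fst ?l}. f i)
        + (fst ?l - fst q) - (snd ?l - snd q) - int (length ps))) / 2)
      {of_int (fst q)..of_int (fst ?l)}"
  proof (rule has_integral_eq[OF _ IH])
    fix x :: real assume "x \<in> {of_int (fst q)..of_int (fst ?l)}"
    \<comment> \<open>At the joint the longer path is evaluated on its first edge and the shorter
      one on its own; both give the ordinate of \<open>q\<close>.\<close>
    moreover have "path_height (q # ps) (of_int (fst q)) = of_int (snd q)"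
      using 3(3) by (intro path_height_vertex) auto
    ultimately show "path_height (q # ps) x = path_height (p # q # ps) x"
      using pq by (cases "x = of_int (fst q)") (auto simp: path_height_Cons2)
  qed
  have total: "of_int (fst q - fst p) * of_int (snd p + snd q) / 2
      + (of_int (2 * (\<Sum>i\<in>{fst q<..fst ?l}. f i)
        + (fst ?l - fst q) - (snd ?l - snd q) - int (length ps))) / 2
    = (of_int (2 * (\<Sum>i\<in>{fst p<..fst ?l}. f i)
        + (fst ?l - fst p) - (snd ?l - snd p) - int (length (p # q # ps) - 1))) / (2 :: real)"
  proof -
    have "(fst q - fst p) * (snd p + snd q)
      + (2 * (\<Sum>i\<in>{fst q<..fst ?l}. f i)
        + (fst ?l - fst q) - (snd ?l - snd q) - int (length ps))
    = 2 * (\<Sum>i\<in>{fst p<..fst ?l}. f i)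
        + (fst ?l - fst p) - (snd ?l - snd p) - int (length (p # q # ps) - 1)"
      using edge unfolding split by simp
    then show ?thesis by (simp only: flip: of_int_mult of_int_add add_divide_distrib)
  qed
  have "real_of_int (fst p) \<le> of_int (fst q)" "real_of_int (fst q) \<le> of_int (fst ?l)"
    using pq ql by simp_all
  from has_integral_combine[OF this left right] show ?case
    unfolding total by simp
qed simp

section \<open>The area of the region and the final count\<close>

text \<open>By Tonelli the planar measure is the integral of the lengths of the vertical slices,
  which are intervals over \<open>{a..b}\<close> and empty elsewhere.\<close>

lemma measure_between_graphs:
  fixes g h :: "real \<Rightarrow> real"
  assumes [measurable]: "g \<in> borel_measurable borel" "h \<in> borel_measurable borel"
    and le: "\<And>x. a \<le> x \<Longrightarrow> x \<le> b \<Longrightarrow> g x \<le> h x"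
    and int: "((\<lambda>x. h x - g x) has_integral I) {a..b}"
  shows "measure lborel {(x, y). a \<le> x \<and> x \<le> b \<and> g x \<le> y \<and> y \<le> h x} = I"
proof -
  let ?R = "{(x, y). a \<le> x \<and> x \<le> b \<and> g x \<le> y \<and> y \<le> h x}"
  have meas: "?R \<in> sets (lborel \<Otimes>\<^sub>M lborel)"
  proof -
    have "{z \<in> space (borel \<Otimes>\<^sub>M borel). a \<le> fst z \<and> fst z \<le> b \<and>
        g (fst z) \<le> snd z \<and> snd z \<le> h (fst z)} \<in> sets (borel \<Otimes>\<^sub>M borel)"
      by measurable
    also have "{z \<in> space (borel \<Otimes>\<^sub>M borel). a \<le> fst z \<and> fst z \<le> b \<and>
        g (fst z) \<le> snd z \<and> snd z \<le> h (fst z)} = ?R"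
      by (auto simp: space_pair_measure)
    finally show ?thesis
      by (simp cong: sets_pair_measure_cong)
  qed
  have slice: "emeasure lborel (Pair x -` ?R) = ennreal (indicator {a..b} x * (h x - g x))" for x
  proof (cases "x \<in> {a..b}")
    case True
    then have "Pair x -` ?R = {g x..h x}" by auto
    then have "emeasure lborel (Pair x -` ?R) = ennreal (h x - g x)"
      using True le[of x] by simp
    then show ?thesis using True by (simp only: indicator_simps mult_1)
  next
    case False
    then have "Pair x -` ?R = {}" by auto
    then have "emeasure lborel (Pair x -` ?R) = 0" by (simp only: emeasure_empty)
    then show ?thesis using False by (simp only: indicator_simps simp_thms mult_zero_left ennreal_0)
  qed
  have "emeasure lborel ?R = emeasure (lborel \<Otimes>\<^sub>M lborel) ?R"
    by (simp only: lborel_prod)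
  also have "\<dots> = (\<integral>\<^sup>+x. emeasure lborel (Pair x -` ?R) \<partial>lborel)"
    by (rule lborel.emeasure_pair_measure_alt[OF meas])
  also have "\<dots> = (\<integral>\<^sup>+x. ennreal (indicator {a..b} x * (h x - g x)) \<partial>lborel)"
    by (simp only: slice)
  also have "\<dots> = ennreal I"
  proof (rule nn_integral_has_integral_lborel)
    have "((\<lambda>x. if x \<in> {a..b} then h x - g x else 0) has_integral I) UNIV"
      using int by (simp only: has_integral_restrict_UNIV)
    moreover have "(\<lambda>x. if x \<in> {a..b} then h x - g x else 0)
        = (\<lambda>x. indicator {a..b} x * (h x - g x))"
      by (auto simp: indicator_def)
    ultimately show "((\<lambda>x. indicator {a..b} x * (h x - g x)) has_integral I) UNIV"
      by simp
  qed (use le in \<open>auto simp: indicator_def\<close>)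
  finally have "emeasure lborel ?R = ennreal I" .
  moreover have "0 \<le> I" using int by (rule has_integral_nonneg) (use le in auto)
  ultimately show ?thesis by (simp add: measure_def)
qed

theorem lemma4p1p2:
  fixes \<theta> :: real and t r :: nat
  assumes "\<theta> > 0" and "\<theta> \<notin> \<rat>" and "t > 0"
    and "r = size (positive_partition \<theta> t)"
  shows "2 * region_area \<theta> t =
    \<theta> * real t ^ 2 - real_of_int (grading \<theta> t) + real t
      + real_of_int \<lfloor>real t * \<theta>\<rfloor> + real r"
proof -
  define f where "f i = \<lfloor>of_int i * \<theta>\<rfloor>" for i :: int
  define vs where "vs = hull_path f (int t)"
  have n: "0 < int t" using \<open>t > 0\<close> by simp
  have max: "is_maximal_path \<theta> t vs"
    using is_maximal_path_hull_path[OF \<open>\<theta> > 0\<close> \<open>t > 0\<close>] by (simp add: vs_def f_def[abs_def])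
  then have path: "maximal_path \<theta> t = vs"
    unfolding maximal_path_def
    by (intro the_equality) (use is_maximal_path_unique[OF \<open>t > 0\<close>] in auto)
  have below: "path_height vs x \<le> \<theta> * x" if "0 \<le> x" "x \<le> real t" for x
    using max that by (auto simp: is_maximal_path_def concave_lattice_path_def)
  have hd: "hd vs = (0, 0)" and last: "last vs = (int t, f (int t))" and len: "2 \<le> length vs"
    using hull_path_endpoints[OF n, of f] by (simp_all add: vs_def f_def)
  \<comment> \<open>Zipping a list with its tail yields one pair per edge.\<close>
  have r: "r = length vs - 1"
    using assms(4) by (simp add: positive_partition_def path Let_def)

  have edge: "2 * (\<Sum>i\<in>{fst (vs ! k)<..fst (vs ! Suc k)}. f i) =
        (fst (vs ! Suc k) - fst (vs ! k)) * (snd (vs ! k) + snd (vs ! Suc k))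
          - (fst (vs ! Suc k) - fst (vs ! k)) + (snd (vs ! Suc k) - snd (vs ! k)) + 1"
    if k: "Suc k < length vs" for k
  proof -
    obtain u w where e: "vs ! k = (u, f u)" "vs ! Suc k = (w, f w)"
      "u < w" "u \<in> hull_abscissae f (int t)" "w \<in> hull_abscissae f (int t)"
      "\<And>i. u < i \<Longrightarrow> i < w \<Longrightarrow> i \<notin> hull_abscissae f (int t)"
      using hull_path_edge[of k f "int t"] k unfolding vs_def by metis
    have uw: "0 \<le> u" "w \<le> int t" using e(4,5) by (auto simp: hull_abscissae_def)
    \<comment> \<open>The edge stays on or below the line of slope \<theta>, because its ends do,
      and that line is strictly below \<open>f i + 1\<close> over \<open>i\<close>. Together with
      the strict lower bound this makes \<open>f i\<close> the integer part of the height of the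
      edge over \<open>i\<close>.\<close>
    have upper: "(f w - f u) * (i - u) < (w - u) * (f i + 1 - f u)" if i: "u < i" "i < w" for i
    proof -
      have "real_of_int ((i - u) * f w + (w - i) * f u) \<le> (i - u) * (w * \<theta>) + (w - i) * (u * \<theta>)"
        unfolding of_int_add of_int_mult f_def using i
        by (intro add_mono mult_left_mono of_int_floor_le) auto
      also have "\<dots> = (w - u) * (i * \<theta>)" by (simp add: algebra_simps)
      also have "\<dots> < (w - u) * real_of_int (f i + 1)"
        using e(3) unfolding f_def by (intro mult_strict_left_mono) linarith+
      finally have "(i - u) * f w + (w - i) * f u < (w - u) * (f i + 1)"
        by (simp only: of_int_less_iff flip: of_int_mult)
      then show ?thesis by (simp add: algebra_simps)
    qed
    have "2 * (\<Sum>i\<in>{u<..w}. f i) = (w - u) * (f u + f w) - (w - u) + (f w - f u) + 1"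
    proof (rule sum_below_edge[OF e(3) _ upper])
      fix i assume "u < i" "i < w"
      then show "(w - u) * (f i - f u) < (f w - f u) * (i - u)"
        using hull_below_edge(2)[OF e(4,5,3,6)] uw by simp
    qed
    then show ?thesis by (simp add: e(1,2))
  qed

  define S where "S = (\<Sum>i\<in>{0<..int t}. f i)"
  have sorted: "sorted_wrt (<) (map fst vs)" by (simp add: vs_def)
  have "vs \<noteq> []" using len by auto
  from has_integral_path_height[OF sorted this edge]
  have int_path: "(path_height vs has_integral (of_int (2 * S + int t - f (int t) - int r)) / 2) {0..real t}"
    by (simp add: hd last r S_def)
  have "((\<lambda>x. \<theta> * x) has_integral \<theta> * (real t)\<^sup>2 / 2 - \<theta> * 0\<^sup>2 / 2) {0..real t}"
    by (intro fundamental_theorem_of_calculus)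
      (auto intro!: derivative_eq_intros simp flip: has_real_derivative_iff_has_vector_derivative)
  from has_integral_diff[OF this int_path]
  have "region_area \<theta> t = \<theta> * (real t)\<^sup>2 / 2 - of_int (2 * S + int t - f (int t) - int r) / 2"
    unfolding region_area_def path
    by (intro measure_between_graphs) (use below in simp_all)
  \<comment> \<open>Each Conley-Zehnder index contributes twice a floor plus 1; the \<open>t\<close>
    ones double the leading summand \<open>t\<close> of the grading.\<close>
  moreover have "grading \<theta> t = 2 * int t + 2 * S"
  proof -
    have "S = (\<Sum>i=1..t. \<lfloor>real i * \<theta>\<rfloor>)"
      unfolding S_def f_def
      by (rule sum.reindex_bij_witness[where i = int and j = nat]) auto
    then show ?thesis
      by (simp add: grading_def conley_zehnder_def sum.distrib sum_distrib_left)
  qed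
  ultimately show ?thesis by (simp add: f_def field_simps)
qed

end
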